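(* Let $\alpha\in\mathbb{R}$ with $\alpha\in(-\infty,-2]\cup[2,\infty)$. Then $\mathcal{M}(\alpha)$ is totally disconnected and is contained in the real line $\mathbb{R}\subset\mathbb{C}$.
   Context: For $c\in\mathbb{C}$ let $f_c(x)=x^2+c$, and let $f_c^n$ denote the $n$-fold composition of $f_c$ with itself. For $\alpha\in\mathbb{C}$, the generalized Mandelbrot set is $\mathcal{M}(\alpha)=\{c\in\mathbb{C} : \sup_{n\in\mathbb{N}}|f_c^n(\alpha)|<+\infty\}$ (equivalently, the set of $c\in\mathbb{C}$ such that $|f_c^n(\alpha)|\not\to\infty$ as $n\to\infty$). *)

theory Defs
  imports "HOL-Analysis.Analysis"
begin

definition quad_map :: "complex \<Rightarrow> complex \<Rightarrow> complex" where
  "quad_map c x = x\<^sup>2 + c"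

(* Finiteness of the supremum is boundedness above in the reals: the real-valued SUP of an
   unbounded set is an unspecified real number, so it cannot be compared with infinity. *)
definition gen_mandelbrot :: "complex \<Rightarrow> complex set" where
  "gen_mandelbrot \<alpha> = {c. bdd_above (range (\<lambda>n. cmod ((quad_map c ^^ n) \<alpha>)))}"

definition totally_disconnected :: "'a::topological_space set \<Rightarrow> bool" where
  "totally_disconnected S \<longleftrightarrow> (\<forall>T. T \<subseteq> S \<and> connected T \<longrightarrow> (\<exists>x. T \<subseteq> {x}))"

end

theory Submission
  imports Defs
begin

text \<open>Let \<open>P\<^sub>n(c)\<close> be the \<open>(n+1)\<close>-st iterate of \<open>\<alpha>\<close>, a monic polynomial in \<open>c\<close> of degree \<open>2\<^sup>n\<close>. When
  \<open>\<bar>\<alpha>\<bar> \<ge> 2\<close>, it oscillates across \<open>[-2, 2]\<close> as often as its degree allows, on an interval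
  \<open>[-L, -2]\<close> that does not depend on \<open>n\<close>. Hence, for \<open>\<bar>t\<bar> < 2\<close>, \<open>P\<^sub>n - t\<close> is a product of \<open>2\<^sup>n\<close>
  real linear factors with roots in \<open>[-L, -2]\<close>.

  For \<open>y \<noteq> 0\<close>, each factor is larger at \<open>x + iy\<close> than at \<open>x\<close> by a fixed ratio \<open>k > 1\<close>; choosing
  \<open>t = 1\<close> or \<open>t = -1\<close> so that \<open>\<bar>P\<^sub>n(x) - t\<bar> \<ge> 1\<close> gives exponential growth in \<open>2\<^sup>n\<close>, so bounded orbits occur
  only for real \<open>c\<close>.

  If the orbits were bounded for all \<open>c\<close> in a real interval, then \<open>\<bar>P\<^sub>n(c)\<bar>\<close> would stay away from 0
  there, since an orbit passing too close to the critical point 0 escapes when \<open>c < -2\<close>. So the roots of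
  \<open>P\<^sub>n\<close> would avoid the interval, and \<open>ln \<bar>P\<^sub>n\<bar>\<close>, a sum of \<open>2\<^sup>n\<close> uniformly concave functions, would be
  bounded above and below with arbitrarily large concavity. This is impossible, as one sees by
  comparing three equally spaced points.\<close>

section \<open>Iterates as polynomials in the parameter\<close>

text \<open>Generic over rings: order arguments use the real version, factorizations the complex
  one. The parameter comes last, so that \<open>quad_iter n a\<close> is a function of it.\<close>

definition quad_iter :: "nat \<Rightarrow> 'a::comm_ring_1 \<Rightarrow> 'a \<Rightarrow> 'a" where
  "quad_iter n a c = ((\<lambda>x. x\<^sup>2 + c) ^^ n) a"

lemma quad_iter_0 [simp]: "quad_iter 0 a c = a"
  by (simp add: quad_iter_def)

lemma quad_iter_Suc [simp]: "quad_iter (Suc n) a c = (quad_iter n a c)\<^sup>2 + c"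
  by (simp add: quad_iter_def)

lemma of_real_quad_iter:
  "quad_iter n (of_real a) (of_real c) = (of_real (quad_iter n a c) :: 'a::{real_algebra_1,comm_ring_1})"
  by (induction n) auto

lemma continuous_on_quad_iter:
  "continuous_on A (quad_iter n (a::'a::{real_normed_algebra,comm_ring_1}))"
proof (induction n)
  case 0
  then show ?case by (simp add: quad_iter_def)
next
  case (Suc n)
  have "quad_iter (Suc n) a = (\<lambda>c. (quad_iter n a c)\<^sup>2 + c)"
    by auto
  with Suc show ?case
    by (auto intro!: continuous_intros simp: power2_eq_square)
qed

lemma quad_iter_poly:
  fixes a :: "'a::idom"
  obtains p where "\<And>c. poly p c = quad_iter (Suc n) a c" "degree p = 2 ^ n" "lead_coeff p = 1"
proof -
  have "\<exists>p. (\<forall>c. poly p c = quad_iter (Suc n) a c) \<and> degree p = 2 ^ n \<and> lead_coeff p = 1"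
  proof (induction n)
    case 0
    show ?case by (rule exI [of _ "[:a\<^sup>2, 1:]"]) simp
  next
    case (Suc n)
    then obtain p where p: "\<And>c. poly p c = quad_iter (Suc n) a c" "degree p = 2 ^ n" "lead_coeff p = 1"
      by blast
    have ne: "p \<noteq> 0" using p(3) by auto
    have deg: "degree (p\<^sup>2) = 2 ^ Suc n"
      using p(2) ne by (simp add: degree_power_eq)
    \<comment> \<open>The square has degree at least 2, so adding the parameter leaves the leading
      term unchanged.\<close>
    have lt: "degree [:0, 1::'a:] < degree (p\<^sup>2)"
      unfolding deg using one_less_power [of "2::nat" "Suc n"] by (simp del: power_Suc)
    have "degree (p\<^sup>2 + [:0, 1:]) = 2 ^ Suc n"
      using degree_add_eq_left [OF lt] deg by simp
    moreover have "lead_coeff (p\<^sup>2 + [:0, 1:]) = 1"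
      using lead_coeff_add_le [OF lt] p(3) by (simp add: lead_coeff_power add.commute)
    moreover have "\<forall>c. poly (p\<^sup>2 + [:0, 1:]) c = quad_iter (Suc (Suc n)) a c"
      using p(1) by (simp add: poly_power)
    ultimately show ?case by blast
  qed
  then show ?thesis using that by blast
qed

section \<open>Alternation and real roots\<close>

text \<open>Expresses, without square roots, that \<open>x\<close> is at least 2 and at least the larger fixed
  point of \<open>x\<^sup>2 + c\<close>.\<close>

definition beyond :: "real \<Rightarrow> real \<Rightarrow> bool" where
  "beyond c x \<longleftrightarrow> 2 \<le> x \<and> x \<le> x\<^sup>2 + c"

text \<open>The inequality |x| \<le> x^2 + c survives squaring both sides and adding c.\<close>

lemma beyond_step:
  assumes "beyond c \<bar>x\<bar>"
  shows "beyond c (x\<^sup>2 + c)"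
proof -
  have "2 \<le> \<bar>x\<bar>" "\<bar>x\<bar> \<le> x\<^sup>2 + c"
    using assms by (auto simp: beyond_def)
  moreover from this have "\<bar>x\<bar>\<^sup>2 \<le> (x\<^sup>2 + c)\<^sup>2"
    by (intro power_mono) auto
  ultimately show ?thesis by (simp add: beyond_def)
qed

text \<open>The inequality amounts to w (w + 2) \<ge> 0. It serves at a zero w of one iterate, where
  the next iterate equals w.\<close>

lemma beyond_neg_param: "w \<le> -2 \<Longrightarrow> beyond w (- w)"
  using mult_mono [of 2 "-w" "-w" "-w"] by (simp add: beyond_def power2_eq_square)

lemma IVT_strict:
  fixes f :: "real \<Rightarrow> real"
  assumes "a < b" "continuous_on {a..b} f" "(f a - t) * (f b - t) < 0"
  obtains x where "a < x" "x < b" "f x = t"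
proof -
  consider "f a < t \<and> t < f b" | "f b < t \<and> t < f a"
    using assms(3) by (auto simp: mult_less_0_iff)
  then obtain x where "a \<le> x" "x \<le> b" "f x = t"
    using IVT' [of f a t b] IVT2' [of f b t a] assms(1,2) by (metis less_eq_real_def)
  moreover from this assms(3) have "x \<noteq> a" "x \<noteq> b" by auto
  ultimately show ?thesis using that by force
qed

lemma beyond_alternating_IVT:
  assumes cont: "continuous_on {v..u} f" and "v < u" "\<bar>t\<bar> < 2"
    and u: "beyond u ((-1) ^ i * f u)" and v: "beyond v ((-1) ^ Suc i * f v)"
  obtains x where "v < x" "x < u" "f x = t"
proof (rule IVT_strict [OF \<open>v < u\<close> cont])
  show "(f v - t) * (f u - t) < 0"
    using u v \<open>\<bar>t\<bar> < 2\<close> by (cases "even i") (auto simp: beyond_def mult_less_0_iff)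
qed

text \<open>Between two consecutive points of the alternation, the iterate has a zero \<open>w\<close>, and there the
  next iterate takes the value \<open>w\<close>; at the old points the next iterate is positive. Inserting the
  zeros thus doubles the number of alternations.\<close>

lemma quad_iter_alternation:
  fixes a :: real
  assumes a: "2 \<le> \<bar>a\<bar>"
  obtains u :: "nat \<Rightarrow> real"
  where "\<And>i. i < 2 ^ n \<Longrightarrow> u (Suc i) < u i"
    and "\<And>i. i \<le> 2 ^ n \<Longrightarrow> u i \<in> {- (a\<^sup>2 + \<bar>a\<bar> + 2).. -2}"
    and "\<And>i. i \<le> 2 ^ n \<Longrightarrow> beyond (u i) ((-1) ^ i * quad_iter (Suc n) a (u i))"
proof -
  have "\<exists>u. (\<forall>i<2 ^ n. u (Suc i) < u i) \<and>
    (\<forall>i\<le>2 ^ n. u i \<in> {- (a\<^sup>2 + \<bar>a\<bar> + 2).. -2} \<and> beyond (u i) ((-1) ^ i * quad_iter (Suc n) a (u i)))"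
  proof (induction n)
    case 0
    have a2: "2 * \<bar>a\<bar> \<le> a\<^sup>2"
      using a mult_mono [of 2 "\<bar>a\<bar>" "\<bar>a\<bar>" "\<bar>a\<bar>"] by (simp add: power2_eq_square abs_mult_self_eq)
    \<comment> \<open>For n = 0 the map is u + a^2. It takes the value |a| at the first point, where
      |a| is then a fixed point, and -(|a| + 2) at the second.\<close>
    define u where "u i = (if i = 0 then \<bar>a\<bar> - a\<^sup>2 else - (a\<^sup>2 + \<bar>a\<bar> + 2))" for i :: nat
    have "(\<bar>a\<bar> + 2)\<^sup>2 = a\<^sup>2 + 4 * \<bar>a\<bar> + 4"
      by (simp add: power2_sum)
    then have "(2 + \<bar>a\<bar>)\<^sup>2 = a\<^sup>2 + 4 * \<bar>a\<bar> + 4"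
      by (simp add: add.commute)
    then have "beyond (u 0) (u 0 + a\<^sup>2)" "beyond (u 1) (- (u 1 + a\<^sup>2))"
      using a by (auto simp: u_def beyond_def)
    moreover have "u 1 < u 0" "u 0 \<in> {- (a\<^sup>2 + \<bar>a\<bar> + 2).. -2}" "u 1 \<in> {- (a\<^sup>2 + \<bar>a\<bar> + 2).. -2}"
      using a a2 by (auto simp: u_def)
    ultimately show ?case
      by (intro exI [of _ u]) (auto simp: le_Suc_eq add.commute)
  next
    case (Suc n)
    let ?P = "quad_iter (Suc n) a"
    from Suc obtain u where dec: "\<And>i. i < 2 ^ n \<Longrightarrow> u (Suc i) < u i"
      and rng: "\<And>i. i \<le> 2 ^ n \<Longrightarrow> u i \<in> {- (a\<^sup>2 + \<bar>a\<bar> + 2).. -2}"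
      and alt: "\<And>i. i \<le> 2 ^ n \<Longrightarrow> beyond (u i) ((-1) ^ i * ?P (u i))"
      by blast
    have "\<exists>w. u (Suc i) < w \<and> w < u i \<and> ?P w = 0" if "i < 2 ^ n" for i
      using beyond_alternating_IVT [OF continuous_on_quad_iter dec [OF that], of 0 i "Suc n" a]
        alt [of i] alt [of "Suc i"] that by (metis Suc_leI abs_zero less_imp_le zero_less_numeral)
    then obtain w where w: "\<And>i. i < 2 ^ n \<Longrightarrow> u (Suc i) < w i \<and> w i < u i \<and> ?P (w i) = 0"
      by metis
    define v where "v j = (if even j then u (j div 2) else w (j div 2))" for j
    have "v (Suc j) < v j" if "j < 2 ^ Suc n" for j
      using that w [of "j div 2"] by (auto simp: v_def elim!: oddE)
    moreover have "v j \<in> {- (a\<^sup>2 + \<bar>a\<bar> + 2).. -2} \<and> beyond (v j) ((-1) ^ j * quad_iter (Suc (Suc n)) a (v j))"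
      if "j \<le> 2 ^ Suc n" for j
    proof (cases "even j")
      case True
      then obtain i where j: "j = 2 * i" by (elim evenE)
      with that have i: "i \<le> 2 ^ n" by simp
      have "beyond (u i) \<bar>?P (u i)\<bar>"
        using alt [OF i] by (cases "even i") (auto simp: beyond_def)
      then have "beyond (u i) ((?P (u i))\<^sup>2 + u i)"
        by (rule beyond_step)
      then show ?thesis
        using rng [OF i] unfolding j v_def quad_iter_Suc [of "Suc n"] by simp
    next
      case False
      then obtain i where j: "j = 2 * i + 1" by (elim oddE)
      with that have i: "i < 2 ^ n" by simp
      then have "w i \<in> {- (a\<^sup>2 + \<bar>a\<bar> + 2).. -2}"
        using w [OF i] rng [of i] rng [of "Suc i"] by auto
      then show ?thesis
        using w [OF i] beyond_neg_param [of "w i"] unfolding j v_def quad_iter_Suc [of "Suc n"] by simp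
    qed
    ultimately show ?case by blast
  qed
  then show ?thesis using that by blast
qed

text \<open>Each of the 2^n gaps of the alternation contains a root; the gaps are disjoint, so the
  roots are distinct.\<close>

lemma quad_iter_real_roots:
  fixes a t :: real
  assumes "2 \<le> \<bar>a\<bar>" "\<bar>t\<bar> < 2"
  obtains S where "finite S" "card S = 2 ^ n" "S \<subseteq> {- (a\<^sup>2 + \<bar>a\<bar> + 2).. -2}"
    "\<And>r. r \<in> S \<Longrightarrow> quad_iter (Suc n) a r = t"
proof -
  let ?P = "quad_iter (Suc n) a"
  obtain u where dec: "\<And>i. i < 2 ^ n \<Longrightarrow> u (Suc i) < u i"
    and rng: "\<And>i. i \<le> 2 ^ n \<Longrightarrow> u i \<in> {- (a\<^sup>2 + \<bar>a\<bar> + 2).. -2}"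
    and alt: "\<And>i. i \<le> 2 ^ n \<Longrightarrow> beyond (u i) ((-1) ^ i * ?P (u i))"
    using quad_iter_alternation [OF assms(1)] by metis
  have "\<exists>w. u (Suc i) < w \<and> w < u i \<and> ?P w = t" if "i < 2 ^ n" for i
    using beyond_alternating_IVT [OF continuous_on_quad_iter dec [OF that] assms(2), of i "Suc n" a]
      alt [of i] alt [of "Suc i"] that by (metis Suc_leI less_imp_le)
  then obtain w where w: "\<And>i. i < 2 ^ n \<Longrightarrow> u (Suc i) < w i \<and> w i < u i \<and> ?P (w i) = t"
    by metis
  have anti: "u j \<le> u i" if "i \<le> j" "j \<le> 2 ^ n" for i j
    using that
  proof (induction j rule: dec_induct)
    case (step j)
    then show ?case using dec [of j] by simp
  qed simp
  have wless: "w j < w i" if "i < j" "j < 2 ^ n" for i j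
    using w [of i] w [of j] anti [of "Suc i" j] that by simp
  have "inj_on w {..<2 ^ n}"
  proof (rule inj_onI)
    fix i j assume "i \<in> {..<2 ^ n}" "j \<in> {..<2 ^ n}" "w i = w j"
    then show "i = j" using wless [of i j] wless [of j i] by (cases i j rule: linorder_cases) auto
  qed
  then have "card (w ` {..<2 ^ n}) = 2 ^ n"
    by (simp add: card_image)
  moreover have "w i \<in> {- (a\<^sup>2 + \<bar>a\<bar> + 2).. -2}" if "i < 2 ^ n" for i
    using that w [of i] rng [of i] rng [of "Suc i"] by auto
  ultimately show ?thesis
    using that [of "w ` {..<2 ^ n}"] w by blast
qed

text \<open>Two monic polynomials of degree \<open>card S\<close> differ by one of smaller degree,
  which cannot vanish on all of S unless it is zero.\<close>

lemma monic_poly_eq_prod_roots: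
  fixes p :: "'a::idom poly"
  assumes "finite S" "card S = degree p" "lead_coeff p = 1" "\<And>s. s \<in> S \<Longrightarrow> poly p s = 0"
  shows "p = (\<Prod>s\<in>S. [:- s, 1:])"
proof (rule poly_eqI_degree_lead_coeff)
  have "degree (\<Prod>s\<in>S. [:- s, 1:]) = card S"
    using assms(1) by (simp add: degree_prod_eq_sum_degree)
  moreover have "lead_coeff (\<Prod>s\<in>S. [:- s, 1:]) = 1"
    by (simp add: lead_coeff_prod)
  ultimately show "coeff p (card S) = coeff (\<Prod>s\<in>S. [:- s, 1:]) (card S)"
    "degree (\<Prod>s\<in>S. [:- s, 1:]) \<le> card S"
    using assms by auto
  show "poly p z = poly (\<Prod>s\<in>S. [:- s, 1:]) z" if "z \<in> S" for z
    using that assms by (auto simp: poly_prod)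
qed (use assms in auto)

text \<open>The real roots already exhaust the degree, so the product formula also holds off the
  real line.\<close>

lemma quad_iter_factorization:
  fixes a t :: real
  assumes "2 \<le> \<bar>a\<bar>" "\<bar>t\<bar> < 2"
  obtains S where "finite S" "card S = 2 ^ n" "S \<subseteq> {- (a\<^sup>2 + \<bar>a\<bar> + 2).. -2}"
    "\<And>r. r \<in> S \<Longrightarrow> quad_iter (Suc n) a r = t"
    "\<And>z::complex. quad_iter (Suc n) (of_real a) z - of_real t = (\<Prod>r\<in>S. z - of_real r)"
proof -
  obtain S where S: "finite S" "card S = 2 ^ n" "S \<subseteq> {- (a\<^sup>2 + \<bar>a\<bar> + 2).. -2}"
    "\<And>r. r \<in> S \<Longrightarrow> quad_iter (Suc n) a r = t"
    using quad_iter_real_roots [OF assms] by metis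
  obtain p where p: "\<And>c. poly p c = quad_iter (Suc n) (complex_of_real a) c" "degree p = 2 ^ n"
    "lead_coeff p = 1"
    using quad_iter_poly by metis
  define q where "q = p + [:- complex_of_real t:]"
  have lt: "degree [:- complex_of_real t:] < degree p"
    using p(2) by simp
  have q: "degree q = 2 ^ n" "lead_coeff q = 1"
    using degree_add_eq_left [OF lt] lead_coeff_add_le [OF lt] p(2,3)
    by (simp_all add: q_def add.commute)
  have "q = (\<Prod>s\<in>of_real ` S. [:- s, 1:])"
  proof (rule monic_poly_eq_prod_roots)
    show "card (complex_of_real ` S) = degree q"
      using S(2) q by (simp add: card_image inj_on_def)
    fix s assume "s \<in> complex_of_real ` S"
    then obtain r where "r \<in> S" "s = of_real r" by blast
    then show "poly q s = 0"
      using S(4) [of r] p(1) of_real_quad_iter [of "Suc n" a r, where 'a = complex]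
      by (simp add: q_def del: quad_iter_Suc)
  qed (use S q in auto)
  then have "poly q z = (\<Prod>r\<in>S. z - of_real r)" for z
    by (simp add: poly_prod prod.reindex inj_on_def)
  then have "quad_iter (Suc n) (of_real a) z - of_real t = (\<Prod>r\<in>S. z - of_real r)" for z :: complex
    using p(1) by (simp add: q_def del: quad_iter_Suc)
  with S show ?thesis using that by blast
qed

section \<open>Bounded orbits force real parameters\<close>

lemma gen_mandelbrot_iff:
  "c \<in> gen_mandelbrot \<alpha> \<longleftrightarrow> (\<exists>B. \<forall>n. cmod (quad_iter n \<alpha> c) \<le> B)"
proof -
  have "quad_map c = (\<lambda>x. x\<^sup>2 + c)"
    by (auto simp: quad_map_def)
  then show ?thesis
    by (auto simp: gen_mandelbrot_def quad_iter_def bdd_above_def)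
qed

lemma gen_mandelbrot_subset_Reals:
  fixes a :: real
  assumes a: "2 \<le> \<bar>a\<bar>"
  shows "gen_mandelbrot (of_real a) \<subseteq> \<real>"
proof
  fix c assume "c \<in> gen_mandelbrot (of_real a)"
  then obtain B where B: "\<And>n. cmod (quad_iter n (of_real a) c) \<le> B"
    by (auto simp: gen_mandelbrot_iff)
  define x y where "x = Re c" and "y = Im c"
  show "c \<in> \<real>"
  proof (rule ccontr)
    assume "c \<notin> \<real>"
    then have y: "y \<noteq> 0" by (simp add: complex_is_Real_iff y_def)
    \<comment> \<open>K bounds |x - r| for every root r, so |c - r| / |x - r| = sqrt (1 + y^2 / (x -
      r)^2) is at least k when x differs from r.\<close>
    define K where "K = \<bar>x\<bar> + (a\<^sup>2 + \<bar>a\<bar> + 2)"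
    define k where "k = sqrt (1 + y\<^sup>2 / K\<^sup>2)"
    have K: "K > 0" unfolding K_def by (smt (verit) zero_le_power2)
    with y have k: "k > 1" by (simp add: k_def)
    have "k ^ 2 ^ n \<le> B + 1" for n
    proof -
      let ?P = "quad_iter (Suc n) (complex_of_real a)"
      have "2 = cmod ((?P x + 1) - (?P x - 1))" by simp
      also have "\<dots> \<le> cmod (?P x + 1) + cmod (?P x - 1)" by (rule norm_triangle_ineq4)
      finally have "1 \<le> cmod (?P x - of_real 1) \<or> 1 \<le> cmod (?P x - of_real (- 1))"
        by auto
      then obtain t :: real where t: "\<bar>t\<bar> = 1" "1 \<le> cmod (?P x - of_real t)"
        by (metis abs_1 abs_minus_cancel)
      have t2: "\<bar>t\<bar> < 2" using t(1) by simp
      obtain S where S: "finite S" "card S = 2 ^ n" "S \<subseteq> {- (a\<^sup>2 + \<bar>a\<bar> + 2).. -2}"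
        "\<And>r. r \<in> S \<Longrightarrow> quad_iter (Suc n) a r = t"
        "\<And>z. ?P z - of_real t = (\<Prod>r\<in>S. z - of_real r)"
        using quad_iter_factorization [OF a t2, where n = n] by blast
      have "k * cmod (x - of_real r) \<le> cmod (c - of_real r)" if "r \<in> S" for r
      proof -
        have "\<bar>x - r\<bar> \<le> K" using subsetD [OF S(3) that] unfolding K_def by auto
        then have "(x - r)\<^sup>2 \<le> K\<^sup>2" using K by (metis abs_le_square_iff abs_of_pos)
        then have "(1 + y\<^sup>2 / K\<^sup>2) * (x - r)\<^sup>2 \<le> (x - r)\<^sup>2 + y\<^sup>2"
          using K mult_left_mono [of "(x - r)\<^sup>2" "K\<^sup>2" "y\<^sup>2"] by (simp add: field_simps)
        then have "sqrt ((1 + y\<^sup>2 / K\<^sup>2) * (x - r)\<^sup>2) \<le> sqrt ((x - r)\<^sup>2 + y\<^sup>2)"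
          by (rule real_sqrt_le_mono)
        moreover have "cmod (x - of_real r) = \<bar>x - r\<bar>"
          by (simp flip: of_real_diff)
        ultimately show ?thesis
          by (simp add: k_def real_sqrt_mult cmod_def x_def y_def)
      qed
      then have "(\<Prod>r\<in>S. k * cmod (x - of_real r)) \<le> (\<Prod>r\<in>S. cmod (c - of_real r))"
        using k by (intro prod_mono) auto
      then have "k ^ 2 ^ n * cmod (?P x - of_real t) \<le> cmod (?P c - of_real t)"
        unfolding S(5) using S(2) by (simp add: prod.distrib prod_norm)
      also have "\<dots> \<le> cmod (?P c) + cmod (of_real t)" by (rule norm_triangle_ineq4)
      also have "\<dots> \<le> B + 1" using B [of "Suc n"] t(1) by simp
      finally have "k ^ 2 ^ n * cmod (?P x - of_real t) \<le> B + 1" .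
      moreover have "k ^ 2 ^ n * 1 \<le> k ^ 2 ^ n * cmod (?P x - of_real t)"
        using t(2) k by (intro mult_left_mono) auto
      ultimately show ?thesis by linarith
    qed
    moreover obtain n where "B + 1 < k ^ n"
      using real_arch_pow [OF k] by blast
    moreover have "k ^ n \<le> k ^ 2 ^ n"
      using k by (intro power_increasing) (auto intro: less_imp_le)
    ultimately show False by (meson less_le_trans not_le)
  qed
qed

section \<open>No interval of bounded parameters\<close>

text \<open>The gain z^2 + c - z increases with z for z \<ge> 2. A positive gain d therefore recurs
  at every later step, and the orbit grows at least linearly.\<close>

lemma quad_iter_bounded_imp_le:
  fixes a c :: real
  assumes "2 \<le> \<bar>quad_iter m a c\<bar>" and bdd: "\<And>n. \<bar>quad_iter n a c\<bar> \<le> B"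
  shows "(quad_iter m a c)\<^sup>2 + c \<le> \<bar>quad_iter m a c\<bar>"
proof (rule ccontr)
  define x where "x = \<bar>quad_iter m a c\<bar>"
  define d where "d = x\<^sup>2 + c - x"
  assume "\<not> ?thesis"
  then have d: "d > 0" by (simp add: d_def x_def)
  have "x + real n * d \<le> \<bar>quad_iter (m + n) a c\<bar>" for n
  proof (induction n)
    case (Suc n)
    define z where "z = \<bar>quad_iter (m + n) a c\<bar>"
    have "2 \<le> x" using assms(1) by (simp add: x_def)
    have "x \<le> x + real n * d" using d by simp
    with Suc have "x \<le> z" by (simp add: z_def)
    with \<open>2 \<le> x\<close> have "0 \<le> (z - x) * (z + x - 1)" by simp
    then have "z + d \<le> z\<^sup>2 + c"
      by (simp add: d_def power2_eq_square algebra_simps)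
    also have "\<dots> \<le> \<bar>quad_iter (m + Suc n) a c\<bar>" by (simp add: z_def)
    finally show ?case using Suc by (simp add: z_def algebra_simps)
  qed (simp add: x_def)
  then have "real n * d \<le> B" for n
    using bdd [of "m + n"] by (smt (verit) x_def)
  moreover obtain n where "B < real n * d"
    using reals_Archimedean3 [OF d] by blast
  ultimately show False by (meson not_le)
qed

text \<open>Write c = -2 - 2e. A square below e makes the next modulus w exceed 2 + e, so w (w - 1)
  > (2 + e)(1 + e) > -c, and the orbit escapes.\<close>

lemma quad_iter_bounded_away:
  fixes a c :: real
  assumes "c < -2" and bdd: "\<And>n. \<bar>quad_iter n a c\<bar> \<le> B"
  shows "(- 2 - c) / 2 \<le> (quad_iter m a c)\<^sup>2"
proof (rule ccontr)
  define e where "e = (- 2 - c) / 2"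
  define w where "w = - c - (quad_iter m a c)\<^sup>2"
  assume "\<not> ?thesis"
  then have w: "2 + e < w" and e: "e > 0"
    using assms(1) by (auto simp: e_def w_def field_simps)
  have it: "\<bar>quad_iter (Suc m) a c\<bar> = w"
    using w e by (simp add: w_def)
  then have "w\<^sup>2 + c \<le> w"
    using quad_iter_bounded_imp_le [of "Suc m" a c B, OF _ bdd] w e
    unfolding power2_abs [of "quad_iter (Suc m) a c", symmetric] it by linarith
  moreover have "(2 + e) * (1 + e) < w * (w - 1)"
    using w e by (intro mult_strict_mono) auto
  ultimately have "2 + 3 * e + e * e < - c"
    by (simp add: power2_eq_square algebra_simps)
  moreover have "c = - 2 - 2 * e" by (simp add: e_def field_simps)
  ultimately show False using e mult_pos_pos [OF e e] by simp
qed

lemma gen_mandelbrot_no_interval: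
  fixes a x y :: real
  assumes a: "2 \<le> \<bar>a\<bar>" and "x < y"
  shows "\<not> of_real ` {x..y} \<subseteq> gen_mandelbrot (of_real a)"
proof
  assume sub: "of_real ` {x..y} \<subseteq> gen_mandelbrot (of_real a)"
  have bdd: "\<exists>B. \<forall>n. \<bar>quad_iter n a c\<bar> \<le> B" if "c \<in> {x..y}" for c
  proof -
    have "complex_of_real c \<in> gen_mandelbrot (of_real a)" using that sub by blast
    then show ?thesis by (simp add: gen_mandelbrot_iff of_real_quad_iter)
  qed
  \<comment> \<open>The starting value already has modulus at least 2, so boundedness gives y \<le>
    |a| - a^2 \<le> -2.\<close>
  have "y \<le> - 2"
  proof -
    obtain B where "\<And>n. \<bar>quad_iter n a y\<bar> \<le> B" using bdd [of y] \<open>x < y\<close> by auto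
    from quad_iter_bounded_imp_le [of 0, OF _ this] a have "a\<^sup>2 + y \<le> \<bar>a\<bar>" by simp
    moreover have "0 \<le> (\<bar>a\<bar> - 2) * (\<bar>a\<bar> + 1)" using a by simp
    ultimately show ?thesis by (simp add: algebra_simps power2_eq_square)
  qed
  have away: "(- 2 - c) / 2 \<le> (quad_iter n a c)\<^sup>2" if "c \<in> {x..<y}" for c n
  proof -
    obtain B where "\<And>n. \<bar>quad_iter n a c\<bar> \<le> B"
      using bdd [of c] \<open>c \<in> {x..<y}\<close> by auto
    moreover have "c < - 2" using that \<open>y \<le> - 2\<close> by auto
    ultimately show ?thesis by (intro quad_iter_bounded_away) auto
  qed
  \<comment> \<open>A quarter of the length keeps both outer points strictly below y, hence below
    -2, where \<open>away\<close> gives a positive bound.\<close>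
  define \<mu> h where "\<mu> = (x + y) / 2" and "h = (y - x) / 4"
  have h: "h > 0" "\<mu> - h \<in> {x..<y}" "\<mu> + h \<in> {x..<y}"
    using \<open>x < y\<close> by (auto simp: \<mu>_def h_def field_simps)
  define K where "K = \<bar>\<mu>\<bar> + h + (a\<^sup>2 + \<bar>a\<bar> + 2)"
  \<comment> \<open>Roots satisfy h \<le> |\<mu> - r| \<le> K, hence (\<mu> - r)^2 - h^2 \<le> k
    (\<mu> - r)^2: concavity of the logarithm, one factor at a time.\<close>
  define k where "k = 1 - h\<^sup>2 / K\<^sup>2"
  have K: "h < K" using a unfolding K_def by (simp add: add_pos_pos add_nonneg_pos)
  then have "h\<^sup>2 < K\<^sup>2" using h by (intro power_strict_mono) auto
  then have k: "0 < k" "k < 1" using K h by (auto simp: k_def)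
  obtain B where B: "\<And>n. \<bar>quad_iter n a \<mu>\<bar> \<le> B"
    using bdd [of \<mu>] \<open>x < y\<close> by (auto simp: \<mu>_def)
  \<comment> \<open>The product of the lower bounds for the squared iterates at the two outer
    points. It does not depend on n, whereas \<open>k ^ 2 ^ n\<close> tends to 0.\<close>
  define e where "e = (- 2 - (\<mu> - h)) / 2 * ((- 2 - (\<mu> + h)) / 2)"
  have "e > 0" using h \<open>y \<le> - 2\<close> unfolding e_def by (intro mult_pos_pos) auto
  have "sqrt e \<le> k ^ 2 ^ n * B\<^sup>2" for n
  proof -
    let ?P = "quad_iter (Suc n) a"
    obtain S where S: "finite S" "card S = 2 ^ n" "S \<subseteq> {- (a\<^sup>2 + \<bar>a\<bar> + 2).. -2}"
      and root: "\<And>r. r \<in> S \<Longrightarrow> ?P r = 0"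
      and prod_eq: "\<And>z::complex. quad_iter (Suc n) (of_real a) z - of_real 0 = (\<Prod>r\<in>S. z - of_real r)"
      using quad_iter_factorization [OF a, where t = 0 and n = n] by auto
    have fac: "?P z = (\<Prod>r\<in>S. z - r)" for z
    proof -
      have "complex_of_real (?P z) = of_real (\<Prod>r\<in>S. z - r)"
        using prod_eq [of "of_real z"] unfolding of_real_quad_iter by simp
      then show ?thesis by (simp only: of_real_eq_iff)
    qed
    have "\<bar>(\<mu> - h) - r\<bar> * \<bar>(\<mu> + h) - r\<bar> \<le> k * \<bar>\<mu> - r\<bar>\<^sup>2" if "r \<in> S" for r
    proof -
      \<comment> \<open>Such an r would lie below -2, where \<open>away\<close> keeps the iterate
        off 0.\<close>
      have "r \<notin> {x..<y}"
        using away [of r "Suc n"] root [OF that] \<open>y \<le> - 2\<close> by auto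
      then have "h \<le> \<bar>\<mu> - r\<bar>" using h by auto
      then have "h\<^sup>2 \<le> (\<mu> - r)\<^sup>2" using h by (metis abs_le_square_iff abs_of_pos)
      have "\<bar>\<mu> - r\<bar> \<le> \<bar>K\<bar>" using subsetD [OF S(3) that] h unfolding K_def by auto
      then have "(\<mu> - r)\<^sup>2 \<le> K\<^sup>2" by (simp add: abs_le_square_iff)
      then have "h\<^sup>2 / K\<^sup>2 * (\<mu> - r)\<^sup>2 \<le> h\<^sup>2"
        using K h mult_left_mono [of "(\<mu> - r)\<^sup>2" "K\<^sup>2" "h\<^sup>2"] by (simp add: field_simps)
      then have "(\<mu> - r)\<^sup>2 - h\<^sup>2 \<le> k * \<bar>\<mu> - r\<bar>\<^sup>2"
        by (simp add: k_def left_diff_distrib)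
      moreover have "\<bar>(\<mu> - h) - r\<bar> * \<bar>(\<mu> + h) - r\<bar> = \<bar>(\<mu> - r)\<^sup>2 - h\<^sup>2\<bar>"
        unfolding abs_mult [symmetric] by (simp add: power2_eq_square algebra_simps)
      ultimately show ?thesis using \<open>h\<^sup>2 \<le> (\<mu> - r)\<^sup>2\<close> by simp
    qed
    then have "(\<Prod>r\<in>S. \<bar>(\<mu> - h) - r\<bar> * \<bar>(\<mu> + h) - r\<bar>) \<le> (\<Prod>r\<in>S. k * \<bar>\<mu> - r\<bar>\<^sup>2)"
      by (intro prod_mono) auto
    then have le: "\<bar>?P (\<mu> - h)\<bar> * \<bar>?P (\<mu> + h)\<bar> \<le> k ^ 2 ^ n * \<bar>?P \<mu>\<bar>\<^sup>2"
      unfolding fac abs_prod using S(2) by (simp add: prod.distrib prod_power_distrib)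
    have "e \<le> (?P (\<mu> - h))\<^sup>2 * (?P (\<mu> + h))\<^sup>2"
      unfolding e_def using h \<open>y \<le> - 2\<close> by (intro mult_mono away) auto
    then have "sqrt e \<le> \<bar>?P (\<mu> - h)\<bar> * \<bar>?P (\<mu> + h)\<bar>"
      by (metis real_sqrt_abs real_sqrt_le_mono real_sqrt_mult)
    also note le
    also have "k ^ 2 ^ n * \<bar>?P \<mu>\<bar>\<^sup>2 \<le> k ^ 2 ^ n * B\<^sup>2"
      using k B [of "Suc n"] by (intro mult_left_mono power_mono) auto
    finally show ?thesis .
  qed
  moreover have "k ^ 2 ^ n \<le> k ^ n" for n
    using k by (intro power_decreasing) (auto intro: less_imp_le)
  ultimately have "sqrt e \<le> k ^ n * B\<^sup>2" for n
    by (meson mult_right_mono order_trans zero_le_power2)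
  moreover have "(\<lambda>n. k ^ n * B\<^sup>2) \<longlonglongrightarrow> 0"
    using k by (auto intro!: tendsto_eq_intros LIMSEQ_power_zero)
  ultimately have "sqrt e \<le> 0"
    by (intro tendsto_lowerbound [where F = sequentially]) auto
  with \<open>e > 0\<close> show False by simp
qed

section \<open>Total disconnectedness\<close>

lemma totally_disconnected_gen_mandelbrot:
  fixes a :: real
  assumes a: "2 \<le> \<bar>a\<bar>"
  shows "totally_disconnected (gen_mandelbrot (of_real a))"
  unfolding totally_disconnected_def
proof (intro allI impI)
  fix T assume T: "T \<subseteq> gen_mandelbrot (complex_of_real a) \<and> connected T"
  then have real: "T \<subseteq> \<real>"
    using gen_mandelbrot_subset_Reals [OF a] by blast
  have "connected (Re ` T)"
    using T by (intro connected_continuous_image continuous_intros) auto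
  \<comment> \<open>T is real, so it contains the whole segment between any two of its points by
    connectedness of its real projection.\<close>
  have *: False if "p \<in> T" "q \<in> T" "Re p < Re q" for p q
  proof -
    have "{Re p..Re q} \<subseteq> Re ` T"
      using \<open>connected (Re ` T)\<close> that by (intro connected_contains_Icc) auto
    then have "of_real ` {Re p..Re q} \<subseteq> T"
      using real by (force simp: subset_iff of_real_Re)
    with T gen_mandelbrot_no_interval [OF a that(3)] show False by blast
  qed
  have "p = q" if "p \<in> T" "q \<in> T" for p q
    using that *[of p q] *[of q p] real
    by (metis linorder_neqE_linordered_idom of_real_Re subsetD)
  then show "\<exists>x. T \<subseteq> {x}" by blast
qed

theorem theorem1p2:
  fixes \<alpha> :: real
  assumes "\<alpha> \<in> {..-2} \<union> {2..}"
  shows "totally_disconnected (gen_mandelbrot (complex_of_real \<alpha>)) \<and>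
         gen_mandelbrot (complex_of_real \<alpha>) \<subseteq> \<real>"
proof -
  have "2 \<le> \<bar>\<alpha>\<bar>" using assms by auto
  then show ?thesis
    using totally_disconnected_gen_mandelbrot gen_mandelbrot_subset_Reals by blast
qed

end
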